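(* Let $T_1$ and $T_2$ be switching equivalent tournaments on the same vertex set $V$. Then $T_1$ is a strong CR tournament if and only if $T_2$ is a strong CR tournament.
   Context: A tournament is a digraph with exactly one arc between each pair of distinct vertices. For distinct vertices write $\theta_T(u,v)=1$ if $u\to v$, $-1$ otherwise. Skew-adjacency matrix $S_T$: entry $1$ if $v_i\to v_j$, $-1$ if $v_j\to v_i$, $0$ on the diagonal; $\det(T)=\det(S_T)$. For odd $k\ge1$, $\mathcal{D}_k$ is the set of tournaments all of whose induced subtournaments have determinant at most $k^2$; $\mathcal{D}_{-1}=\emptyset$. The switch of $T$ w.r.t. $W\subseteq V(T)$ reverses all arcs between $W$ and $V(T)\setminus W$; $T$ and its switches are switching equivalent. A diamond is a 4-tournament consisting of a 3-cycle plus a vertex dominating all of it or dominated by all of it. A 1-transitive blowup of $T$ (vertices $v_1,\dots,v_n$) is obtained by replacing one vertex $v_i$ by two vertices $x\to y$, each of which has the same relation to every $v_j$ ($j\neq i$) as $v_i$ had. Two vertices $u_1,u_2$ of $T$ are covertices and revertices if $|V(T)|=2$; if $|V(T)|\ge3$ they are covertices if $\theta_T(u_1,v)=\theta_T(u_2,v)$ for all other $v$, revertices if $\theta_T(u_1,v)=-\theta_T(u_2,v)$ for all other $v$; CR-associated if covertices or revertices. For $u\notin V(T)=\{w_1,\dots,w_n\}$ and $\sigma=(r_1,\dots,r_n)\in\{\pm1\}^n$, $T(u,\sigma)$ extends $T$ by $u$ with $u\to w_i$ iff $r_i=1$; $u$ is a CR vertex for $T$ with $\sigma$ if $u$ is CR-associated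 in $T(u,\sigma)$ with some vertex of $T$, otherwise a non-CR vertex. Let $T\in\mathcal{D}_k\setminus\mathcal{D}_{k-2}$ for some odd $k$. $T$ is a CR tournament if $T$ is a 1-tournament, a 2-tournament or a diamond, or else for every $u\notin V(T)$ and every $\sigma$ with $u$ a non-CR vertex for $T$ with $\sigma$, $T(u,\sigma)\notin\mathcal{D}_k$. A strong CR tournament is a CR tournament all of whose 1-transitive blowups are CR tournaments. *)

theory Defs
  imports
    "Graph_Theory.Pair_Digraph"
    "Graph_Theory.Digraph_Component"
    "Jordan_Normal_Form.Determinant"
    "HOL-Library.Infinite_Typeclass"
begin

text \<open>
  Tournaments are finite loop-free digraphs whose arcs are pairs of vertices. Notions that
  quantify over new vertices (CR tournaments and blowups) take them from the vertex type. They
  require that type to be infinite, since otherwise a tournament might have no extension at all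
  and satisfy the CR condition vacuously.
\<close>

definition tournament :: "'a pair_pre_digraph \<Rightarrow> bool" where
  "tournament T \<longleftrightarrow> pair_digraph T \<and>
     (\<forall>u \<in> pverts T. \<forall>v \<in> pverts T. u \<noteq> v \<longrightarrow> ((u, v) \<in> parcs T \<longleftrightarrow> (v, u) \<notin> parcs T))"

definition theta :: "'a pair_pre_digraph \<Rightarrow> 'a \<Rightarrow> 'a \<Rightarrow> int" where
  "theta T u v = (if (u, v) \<in> parcs T then 1 else - 1)"

definition skew_adjacency_mat :: "'a pair_pre_digraph \<Rightarrow> 'a list \<Rightarrow> int mat" where
  "skew_adjacency_mat T vs = mat (length vs) (length vs)
     (\<lambda>(i, j). if i = j then 0 else theta T (vs ! i) (vs ! j))"

text \<open>The choice of the enumeration of the vertices does not matter, see \<open>tdet_eq\<close> below.\<close>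

definition tdet :: "'a pair_pre_digraph \<Rightarrow> int" where
  "tdet T = det (skew_adjacency_mat T (SOME vs. distinct vs \<and> set vs = pverts T))"

lemma det_skew_adjacency_mat_cong:
  assumes "distinct vs" "distinct ws" "set vs = set ws"
  shows "det (skew_adjacency_mat T vs) = det (skew_adjacency_mat T ws)"
proof -
  define n where "n = length vs"
  from assms have "mset ws = mset vs"
    by (simp add: set_eq_iff_mset_eq_distinct)
  then obtain p where p: "p permutes {..<length vs}" "permute_list p vs = ws"
    by (rule mset_eq_permutation)
  have p': "p permutes {0..<n}"
    using p(1) by (simp add: n_def lessThan_atLeast0)
  have len: "length ws = n" using p(2) n_def by auto
  have pn: "p i < n" if "i < n" for i
    using permutes_in_image[OF p', of i] that by auto
  define A where "A = skew_adjacency_mat T vs"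
  define B where "B = mat n n (\<lambda>(i, j). A $$ (p i, j))"
  have A: "A \<in> carrier_mat n n" by (auto simp: A_def skew_adjacency_mat_def n_def)
  have B: "B \<in> carrier_mat n n" by (auto simp: B_def)
  have detB: "det B = signof p * det A"
    unfolding B_def by (rule det_permute_rows[OF A p'])
  define C where "C = mat n n (\<lambda>(i, j). (transpose_mat B) $$ (p i, j))"
  have detC: "det C = signof p * det B"
    unfolding C_def using det_permute_rows[OF _ p', of "transpose_mat B"] B det_transpose[OF B]
    by simp
  have C: "C \<in> carrier_mat n n" by (auto simp: C_def)
  have nth: "ws ! i = vs ! p i" if "i < n" for i
    using p that permute_list_nth[OF p(1), of i] by (auto simp: n_def)
  have inj: "p i = p j \<longleftrightarrow> i = j" for i j
    using permutes_inj[OF p'] by (auto dest: injD)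
  have "skew_adjacency_mat T ws = transpose_mat C"
    by (rule eq_matI)
      (auto simp: skew_adjacency_mat_def len C_def B_def A_def pn nth inj n_def[symmetric])
  then have "det (skew_adjacency_mat T ws) = signof p * (signof p * det A)"
    using det_transpose[OF C] detB detC by simp
  also have "\<dots> = det A" by (simp add: sign_def)
  finally show ?thesis by (simp add: A_def)
qed

lemma tdet_eq:
  assumes "distinct vs" "set vs = pverts T"
  shows "tdet T = det (skew_adjacency_mat T vs)"
proof -
  let ?ws = "SOME vs. distinct vs \<and> set vs = pverts T"
  have "distinct ?ws \<and> set ?ws = pverts T"
    by (rule someI[of _ vs]) (use assms in simp)
  then show ?thesis
    unfolding tdet_def by (intro det_skew_adjacency_mat_cong) (use assms in auto)
qed

definition induced_subtournament :: "'a pair_pre_digraph \<Rightarrow> 'a set \<Rightarrow> 'a pair_pre_digraph" where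
  "induced_subtournament T W = \<lparr>pverts = W, parcs = parcs T \<inter> W \<times> W\<rparr>"

lemma with_proj_induced_subtournament:
  "with_proj (induced_subtournament T W) = with_proj T \<restriction> W"
  by (auto simp: with_proj_def induced_subtournament_def induce_subgraph_def)

text \<open>
  The guard \<open>k \<ge> 1\<close> makes the class empty for \<open>k = -1\<close>. The empty induced subtournament has
  determinant 1 and imposes no condition.
\<close>

definition Dclass :: "int \<Rightarrow> 'a pair_pre_digraph set" where
  "Dclass k = {T. tournament T \<and> k \<ge> 1 \<and>
     (\<forall>W \<subseteq> pverts T. tdet (induced_subtournament T W) \<le> k\<^sup>2)}"

definition switch :: "'a pair_pre_digraph \<Rightarrow> 'a set \<Rightarrow> 'a pair_pre_digraph" where
  "switch T W = \<lparr>pverts = pverts T,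
     parcs = {(u, v). if u \<in> W \<longleftrightarrow> v \<in> W then (u, v) \<in> parcs T else (v, u) \<in> parcs T}\<rparr>"

definition switching_equivalent :: "'a pair_pre_digraph \<Rightarrow> 'a pair_pre_digraph \<Rightarrow> bool" where
  "switching_equivalent T1 T2 \<longleftrightarrow> (\<exists>W \<subseteq> pverts T1. T2 = switch T1 W)"

definition diamond :: "'a pair_pre_digraph \<Rightarrow> bool" where
  "diamond T \<longleftrightarrow> tournament T \<and> (\<exists>a b c d. distinct [a, b, c, d] \<and> pverts T = {a, b, c, d} \<and>
     {(a, b), (b, c), (c, a)} \<subseteq> parcs T \<and>
     ({(d, a), (d, b), (d, c)} \<subseteq> parcs T \<or> {(a, d), (b, d), (c, d)} \<subseteq> parcs T))"

text \<open>In a tournament on two vertices both conditions hold vacuously.\<close>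

definition covertices :: "'a pair_pre_digraph \<Rightarrow> 'a \<Rightarrow> 'a \<Rightarrow> bool" where
  "covertices T u1 u2 \<longleftrightarrow> u1 \<in> pverts T \<and> u2 \<in> pverts T \<and> u1 \<noteq> u2 \<and>
     (\<forall>v \<in> pverts T - {u1, u2}. theta T u1 v = theta T u2 v)"

definition revertices :: "'a pair_pre_digraph \<Rightarrow> 'a \<Rightarrow> 'a \<Rightarrow> bool" where
  "revertices T u1 u2 \<longleftrightarrow> u1 \<in> pverts T \<and> u2 \<in> pverts T \<and> u1 \<noteq> u2 \<and>
     (\<forall>v \<in> pverts T - {u1, u2}. theta T u1 v = - theta T u2 v)"

definition CR_associated :: "'a pair_pre_digraph \<Rightarrow> 'a \<Rightarrow> 'a \<Rightarrow> bool" where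
  "CR_associated T u1 u2 \<longleftrightarrow> covertices T u1 u2 \<or> revertices T u1 u2"

text \<open>A sign vector is a function on the vertices, used only for \<open>\<sigma> \<in> pverts T \<rightarrow> {1, -1}\<close>.\<close>

definition extension :: "'a pair_pre_digraph \<Rightarrow> 'a \<Rightarrow> ('a \<Rightarrow> int) \<Rightarrow> 'a pair_pre_digraph" where
  "extension T u \<sigma> = \<lparr>pverts = insert u (pverts T),
     parcs = parcs T \<union> {(u, w) |w. w \<in> pverts T \<and> \<sigma> w = 1}
                     \<union> {(w, u) |w. w \<in> pverts T \<and> \<sigma> w \<noteq> 1}\<rparr>"

definition CR_vertex :: "'a pair_pre_digraph \<Rightarrow> 'a \<Rightarrow> ('a \<Rightarrow> int) \<Rightarrow> bool" where
  "CR_vertex T u \<sigma> \<longleftrightarrow> (\<exists>w \<in> pverts T. CR_associated (extension T u \<sigma>) u w)"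

definition CR_tournament :: "'a::infinite pair_pre_digraph \<Rightarrow> bool" where
  "CR_tournament T \<longleftrightarrow> (\<exists>k. odd k \<and> T \<in> Dclass k - Dclass (k - 2) \<and>
     (card (pverts T) = 1 \<or> card (pverts T) = 2 \<or> diamond T \<or>
      (\<forall>u \<sigma>. u \<notin> pverts T \<and> \<sigma> \<in> pverts T \<rightarrow> {1, - 1} \<and> \<not> CR_vertex T u \<sigma> \<longrightarrow>
         extension T u \<sigma> \<notin> Dclass k)))"

definition transitive_blowup ::
  "'a pair_pre_digraph \<Rightarrow> 'a \<Rightarrow> 'a \<Rightarrow> 'a \<Rightarrow> 'a pair_pre_digraph" where
  "transitive_blowup T v x y = \<lparr>pverts = (pverts T - {v}) \<union> {x, y},
     parcs = {(a, b). (a, b) \<in> parcs T \<and> a \<noteq> v \<and> b \<noteq> v}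
       \<union> {(z, w) |z w. z \<in> {x, y} \<and> w \<noteq> v \<and> (v, w) \<in> parcs T}
       \<union> {(w, z) |z w. z \<in> {x, y} \<and> w \<noteq> v \<and> (w, v) \<in> parcs T}
       \<union> {(x, y)}\<rparr>"

text \<open>
  The new vertices may be any two distinct elements outside the remaining vertices, so one of
  them may be the replaced vertex itself.
\<close>

definition is_one_transitive_blowup ::
  "'a::infinite pair_pre_digraph \<Rightarrow> 'a pair_pre_digraph \<Rightarrow> bool" where
  "is_one_transitive_blowup T T' \<longleftrightarrow>
     (\<exists>v \<in> pverts T. \<exists>x y. x \<noteq> y \<and> x \<notin> pverts T - {v} \<and> y \<notin> pverts T - {v} \<and>
        T' = transitive_blowup T v x y)"

definition strong_CR_tournament :: "'a::infinite pair_pre_digraph \<Rightarrow> bool" where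
  "strong_CR_tournament T \<longleftrightarrow> CR_tournament T \<and>
     (\<forall>T'. is_one_transitive_blowup T T' \<longrightarrow> CR_tournament T')"

lemma pair_digraph_iff:
  "pair_digraph T \<longleftrightarrow> finite (pverts T) \<and> parcs T \<subseteq> pverts T \<times> pverts T \<and> (\<forall>u. (u, u) \<notin> parcs T)"
  (is "_ \<longleftrightarrow> ?R")
proof
  assume "pair_digraph T"
  then interpret pair_digraph T .
  have "(u, u) \<notin> parcs T" for u using pair_no_loops by force
  then show ?R using pair_finite_verts in_arcsD1 in_arcsD2 by auto
next
  assume R: ?R
  then have "finite (parcs T)" by (meson finite_SigmaI finite_subset)
  with R show "pair_digraph T" by unfold_locales auto
qed

lemma tournament_iff:
  "tournament T \<longleftrightarrow> finite (pverts T) \<and> parcs T \<subseteq> pverts T \<times> pverts T \<and>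
     (\<forall>u. (u, u) \<notin> parcs T) \<and>
     (\<forall>u \<in> pverts T. \<forall>v \<in> pverts T. u \<noteq> v \<longrightarrow> ((u, v) \<in> parcs T \<longleftrightarrow> (v, u) \<notin> parcs T))"
  unfolding tournament_def pair_digraph_iff by blast

lemma tournament_switch:
  assumes "tournament T"
  shows "tournament (switch T W)"
proof -
  have mem: "(a, b) \<in> parcs (switch T W) \<longleftrightarrow>
      (if a \<in> W \<longleftrightarrow> b \<in> W then (a, b) \<in> parcs T else (b, a) \<in> parcs T)" for a b
    by (simp add: switch_def)
  have vs: "pverts (switch T W) = pverts T" by (simp add: switch_def)
  have "parcs (switch T W) \<subseteq> pverts T \<times> pverts T"
  proof (rule subrelI)
    fix a b assume "(a, b) \<in> parcs (switch T W)"
    then have "(a, b) \<in> parcs T \<or> (b, a) \<in> parcs T" unfolding mem by presburger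
    then show "(a, b) \<in> pverts T \<times> pverts T" using assms unfolding tournament_iff by blast
  qed
  moreover have "(a, b) \<in> parcs (switch T W) \<longleftrightarrow> (b, a) \<notin> parcs (switch T W)"
    if "a \<in> pverts T" "b \<in> pverts T" "a \<noteq> b" for a b
  proof -
    have "(a, b) \<in> parcs T \<longleftrightarrow> (b, a) \<notin> parcs T"
      using assms that unfolding tournament_iff by blast
    then show ?thesis unfolding mem by presburger
  qed
  moreover have "(a, a) \<notin> parcs (switch T W)" for a
    using assms unfolding tournament_iff mem by simp
  ultimately show ?thesis
    using assms unfolding tournament_iff vs by blast
qed

lemma tournament_extension:
  assumes "tournament T" "u \<notin> pverts T"
  shows "tournament (extension T u \<sigma>)"
proof -
  let ?E = "extension T u \<sigma>"
  have arcs: "(a, b) \<in> parcs T \<Longrightarrow> a \<in> pverts T \<and> b \<in> pverts T \<and> a \<noteq> b" for a b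
    using assms(1) unfolding tournament_iff by blast
  have one: "a \<in> pverts T \<Longrightarrow> b \<in> pverts T \<Longrightarrow> a \<noteq> b \<Longrightarrow>
      (a, b) \<in> parcs T \<longleftrightarrow> (b, a) \<notin> parcs T" for a b
    using assms(1) unfolding tournament_iff by blast
  have vs: "pverts ?E = insert u (pverts T)" by (simp add: extension_def)
  have mem: "(a, b) \<in> parcs ?E \<longleftrightarrow> (a, b) \<in> parcs T \<or>
      (a = u \<and> b \<in> pverts T \<and> \<sigma> b = 1) \<or> (b = u \<and> a \<in> pverts T \<and> \<sigma> a \<noteq> 1)" for a b
    unfolding extension_def by auto
  have "parcs ?E \<subseteq> pverts ?E \<times> pverts ?E"
    by (rule subrelI) (use arcs in \<open>auto simp: mem vs\<close>)
  moreover have "(a, a) \<notin> parcs ?E" for a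
    unfolding mem using arcs assms(2) by blast
  moreover have "(a, b) \<in> parcs ?E \<longleftrightarrow> (b, a) \<notin> parcs ?E"
    if "a \<in> pverts ?E" "b \<in> pverts ?E" "a \<noteq> b" for a b
    using that assms(2) one[of a b] arcs[of a b] arcs[of b a] unfolding mem vs by blast
  moreover have "finite (pverts ?E)"
    using assms(1) unfolding vs tournament_iff by simp
  ultimately show ?thesis unfolding tournament_iff by blast
qed

lemma tournament_transitive_blowup:
  assumes "tournament T" "v \<in> pverts T" "x \<noteq> y" "x \<notin> pverts T - {v}" "y \<notin> pverts T - {v}"
  shows "tournament (transitive_blowup T v x y)"
proof -
  let ?B = "transitive_blowup T v x y"
  define U where "U = pverts T - {v}"
  have arcs: "(a, b) \<in> parcs T \<Longrightarrow> a \<in> pverts T \<and> b \<in> pverts T \<and> a \<noteq> b" for a b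
    using assms(1) unfolding tournament_iff by blast
  have one: "a \<in> pverts T \<Longrightarrow> b \<in> pverts T \<Longrightarrow> a \<noteq> b \<Longrightarrow>
      (a, b) \<in> parcs T \<longleftrightarrow> (b, a) \<notin> parcs T" for a b
    using assms(1) unfolding tournament_iff by blast
  have xyU: "x \<notin> U" "y \<notin> U" using assms by (auto simp: U_def)
  have vs: "pverts ?B = U \<union> {x, y}"
    by (simp add: transitive_blowup_def U_def)
  have mem: "(a, b) \<in> parcs ?B \<longleftrightarrow>
      (a \<in> U \<and> b \<in> U \<and> (a, b) \<in> parcs T) \<or>
      (a \<in> {x, y} \<and> b \<in> U \<and> (v, b) \<in> parcs T) \<or>
      (a \<in> U \<and> b \<in> {x, y} \<and> (a, v) \<in> parcs T) \<or> (a = x \<and> b = y)" for a b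
    using arcs[of a b] arcs[of v b] arcs[of a v]
    unfolding transitive_blowup_def U_def by auto
  have "parcs ?B \<subseteq> pverts ?B \<times> pverts ?B"
    by (rule subrelI) (auto simp: mem vs)
  moreover have "(a, a) \<notin> parcs ?B" for a
    unfolding mem using arcs[of a a] assms(3) xyU by blast
  moreover have "(a, b) \<in> parcs ?B \<longleftrightarrow> (b, a) \<notin> parcs ?B"
    if ab: "a \<in> pverts ?B" "b \<in> pverts ?B" "a \<noteq> b" for a b
  proof -
    have o1: "(a, b) \<in> parcs T \<longleftrightarrow> (b, a) \<notin> parcs T" if "a \<in> U" "b \<in> U"
      using that one[of a b] ab(3) unfolding U_def by blast
    have o2: "(v, z) \<in> parcs T \<longleftrightarrow> (z, v) \<notin> parcs T" if "z \<in> U" for z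
      using that one[of v z] assms(2) unfolding U_def by blast
    consider "a \<in> U" "b \<in> U" | "a \<in> U" "b \<in> {x, y}" | "a \<in> {x, y}" "b \<in> U"
      | "a \<in> {x, y}" "b \<in> {x, y}"
      using ab vs by blast
    then show ?thesis
    proof cases
      case 1
      then show ?thesis unfolding mem using o1 xyU by blast
    next
      case 2
      then show ?thesis unfolding mem using o2 xyU by blast
    next
      case 3
      then show ?thesis unfolding mem using o2 xyU by blast
    next
      case 4
      then show ?thesis unfolding mem using ab(3) assms(3) xyU by blast
    qed
  qed
  moreover have "finite (pverts ?B)"
    using assms(1) unfolding vs U_def tournament_iff by simp
  ultimately show ?thesis unfolding tournament_iff by blast
qed

end

theory Submission
  imports Defs
begin

text \<open>
  Switching conjugates the skew-adjacency matrix by a diagonal sign matrix, so all subtournament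
  determinants, and hence the classes \<open>Dclass k\<close>, are preserved. It commutes with extensions (the
  sign vector changes sign on the switched set) and with blowups (the two new vertices inherit the
  side of the replaced one), and it maps CR-associated pairs to CR-associated pairs and diamonds
  to diamonds.
\<close>

section \<open>Switching as an operation on arcs and signs\<close>

lemma pverts_switch [simp]: "pverts (switch T W) = pverts T"
  by (simp add: switch_def)

lemma parcs_switch:
  "(a, b) \<in> parcs (switch T W) \<longleftrightarrow> (if a \<in> W \<longleftrightarrow> b \<in> W then (a, b) \<in> parcs T else (b, a) \<in> parcs T)"
  by (simp add: switch_def)

lemma pair_pre_digraph_eqI:
  fixes S T :: "'a pair_pre_digraph"
  assumes "pverts S = pverts T" "\<And>a b. (a, b) \<in> parcs S \<longleftrightarrow> (a, b) \<in> parcs T"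
  shows "S = T"
  using assms by (cases S, cases T) auto

lemma switch_switch: "switch (switch T W) W = T"
  by (rule pair_pre_digraph_eqI) (auto simp: parcs_switch)

text \<open>Lets a finite set be switched one vertex at a time. If \<open>w\<close> were already in
  \<open>W\<close>, the extra switch would undo its earlier one.\<close>

lemma switch_insert:
  assumes "w \<notin> W"
  shows "switch T (insert w W) = switch (switch T W) {w}"
  by (rule pair_pre_digraph_eqI) (use assms in \<open>auto simp: parcs_switch\<close>)

lemma switch_empty: "switch T {} = T"
  by (rule pair_pre_digraph_eqI) (auto simp: parcs_switch)

text \<open>\<open>theta\<close> is -1 also where there is no arc, so reversal negates it only
  because exactly one of \<open>(a, b)\<close> and \<open>(b, a)\<close> is an arc.\<close>

lemma theta_switch:
  assumes "tournament T" "a \<in> pverts T" "b \<in> pverts T" "a \<noteq> b"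
  shows "theta (switch T W) a b = (if a \<in> W \<longleftrightarrow> b \<in> W then theta T a b else - theta T a b)"
proof -
  have "(a, b) \<in> parcs T \<longleftrightarrow> (b, a) \<notin> parcs T"
    using assms unfolding tournament_iff by blast
  then show ?thesis by (simp add: theta_def parcs_switch)
qed

section \<open>Determinants and the classes \<open>Dclass k\<close>\<close>

lemma tdet_switch:
  assumes T: "tournament T"
  shows "tdet (switch T W) = tdet T"
proof -
  have "finite (pverts T)" using T unfolding tournament_iff by blast
  then obtain vs where vs: "distinct vs" "set vs = pverts T"
    using finite_distinct_list by blast
  define n where "n = length vs"
  define s :: "nat \<Rightarrow> int" where "s i = (if vs ! i \<in> W then - 1 else 1)" for i
  define A where "A = skew_adjacency_mat T vs"
  define D where "D = mat_diag n s"
  have A: "A \<in> carrier_mat n n" by (auto simp: A_def skew_adjacency_mat_def n_def)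
  have D: "D \<in> carrier_mat n n" by (simp add: D_def)
  \<comment> \<open>Only the square of \<open>det D\<close> enters below, so its sign, the parity of
    the switched set, need not be known.\<close>
  have "D * D = 1\<^sub>m n"
    unfolding D_def mat_diag_diag by (auto simp: s_def mat_diag_def intro!: eq_matI)
  then have dd: "det D * det D = 1"
    using det_mult[OF D D] by simp
  have "skew_adjacency_mat (switch T W) vs = D * (A * D)"
  proof (rule eq_matI)
    fix i j assume "i < dim_row (D * (A * D))" "j < dim_col (D * (A * D))"
    then have ij: "i < n" "j < n" using D by auto
    have "(D * (A * D)) $$ (i, j) = s i * (A $$ (i, j) * s j)"
      using ij A D unfolding D_def
      by (simp add: mat_diag_mult_left[of _ n n] mat_diag_mult_right[of _ n n])
    also have "\<dots> = skew_adjacency_mat (switch T W) vs $$ (i, j)"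
    proof (cases "i = j")
      case True
      then show ?thesis using ij by (simp add: A_def skew_adjacency_mat_def n_def)
    next
      case False
      \<comment> \<open>The factor \<open>s i * s j\<close> is -1 exactly when one of the two
        vertices lies in \<open>W\<close>, that is, when their arc is reversed.\<close>
      then have "theta (switch T W) (vs ! i) (vs ! j) = s i * s j * theta T (vs ! i) (vs ! j)"
        using ij vs T
        by (subst theta_switch) (auto simp: n_def s_def nth_eq_iff_index_eq dest: nth_mem)
      with False ij show ?thesis by (simp add: A_def skew_adjacency_mat_def n_def)
    qed
    finally show "skew_adjacency_mat (switch T W) vs $$ (i, j) = (D * (A * D)) $$ (i, j)"
      by simp
  qed (use D in \<open>auto simp: skew_adjacency_mat_def n_def\<close>)
  then have "det (skew_adjacency_mat (switch T W) vs) = det D * (det A * det D)"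
    using A D det_mult[OF A D] det_mult[of D n "A * D"] by simp
  also have "\<dots> = det A" using dd by (simp add: algebra_simps)
  finally show ?thesis using vs by (simp add: A_def tdet_eq)
qed

lemma tournament_induced_subtournament:
  assumes "tournament T" "U \<subseteq> pverts T"
  shows "tournament (induced_subtournament T U)"
  using assms finite_subset unfolding tournament_iff induced_subtournament_def by fastforce

text \<open>Membership in \<open>W\<close> matters only for endpoints of arcs, so \<open>W\<close>
  may keep its vertices outside \<open>U\<close>.\<close>

lemma induced_subtournament_switch:
  "induced_subtournament (switch T W) U = switch (induced_subtournament T U) W"
  by (rule pair_pre_digraph_eqI) (auto simp: induced_subtournament_def switch_def)

lemma Dclass_switch: "switch T W \<in> Dclass k \<longleftrightarrow> T \<in> Dclass k"
proof -
  have "switch T W \<in> Dclass k" if "T \<in> Dclass k" for T :: "'a pair_pre_digraph"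
    using that unfolding Dclass_def
    by (auto simp: induced_subtournament_switch tdet_switch tournament_switch
        tournament_induced_subtournament)
  \<comment> \<open>The second instance gives the converse, since switching by \<open>W\<close>
    twice restores \<open>T\<close>.\<close>
  from this[of T] this[of "switch T W"] show ?thesis by (auto simp: switch_switch)
qed

section \<open>Diamonds\<close>

lemma diamondI:
  assumes "tournament T" "distinct [a, b, c, d]" "pverts T = {a, b, c, d}"
    and "(a, b) \<in> parcs T" "(b, c) \<in> parcs T" "(c, a) \<in> parcs T"
    and "{(d, a), (d, b), (d, c)} \<subseteq> parcs T \<or> {(a, d), (b, d), (c, d)} \<subseteq> parcs T"
  shows "diamond T"
  using assms unfolding diamond_def by blast

text \<open>Switching the apex \<open>d\<close> exchanges dominating and dominated. Switching a
  cycle vertex draws the apex into a new 3-cycle and turns another cycle vertex into the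
  apex.\<close>

lemma diamond_switch_vertex:
  assumes "diamond T" "w \<in> pverts T"
  shows "diamond (switch T {w})"
proof -
  have T: "tournament (switch T {w})"
    using assms(1) tournament_switch unfolding diamond_def by blast
  obtain a b c d where abcd: "distinct [a, b, c, d]" "pverts T = {a, b, c, d}"
    "(a, b) \<in> parcs T" "(b, c) \<in> parcs T" "(c, a) \<in> parcs T"
    "{(d, a), (d, b), (d, c)} \<subseteq> parcs T \<or> {(a, d), (b, d), (c, d)} \<subseteq> parcs T"
    using assms(1) unfolding diamond_def by auto
  show ?thesis
  proof (cases "w = d")
    case True
    then show ?thesis
      using abcd by (intro diamondI[of _ a b c d] T) (auto simp: parcs_switch)
  next
    case False
    \<comment> \<open>By the rotational symmetry of the 3-cycle we may assume that it starts at \<open>w\<close>.\<close>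
    obtain b c where wbcd: "distinct [w, b, c, d]" "pverts T = {w, b, c, d}"
      "(w, b) \<in> parcs T" "(b, c) \<in> parcs T" "(c, w) \<in> parcs T"
      "{(d, w), (d, b), (d, c)} \<subseteq> parcs T \<or> {(w, d), (b, d), (c, d)} \<subseteq> parcs T"
    proof -
      consider "w = a" | "w = b" | "w = c" using False assms(2) abcd(2) by blast
      then show ?thesis
        using that[of b c] that[of c a] that[of a b] abcd by cases auto
    qed
    from wbcd(6) show ?thesis
    proof
      assume "{(d, w), (d, b), (d, c)} \<subseteq> parcs T"
      \<comment> \<open>The new cycle is \<open>w\<close>, \<open>d\<close>, \<open>b\<close>, and
        \<open>c\<close> is dominated by all of it.\<close>
      with wbcd show ?thesis
        by (intro diamondI[of _ w d b c] T) (auto simp: parcs_switch)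
    next
      assume "{(w, d), (b, d), (c, d)} \<subseteq> parcs T"
      \<comment> \<open>The new cycle is \<open>d\<close>, \<open>w\<close>, \<open>c\<close>, and
        \<open>b\<close> dominates all of it.\<close>
      with wbcd show ?thesis
        by (intro diamondI[of _ d w c b] T) (auto simp: parcs_switch)
    qed
  qed
qed

lemma diamond_switch:
  assumes "diamond T" "W \<subseteq> pverts T"
  shows "diamond (switch T W)"
proof -
  have "finite (pverts T)"
    using assms(1) unfolding diamond_def by auto
  with assms(2) have "finite W" by (rule finite_subset)
  then show ?thesis using assms(2)
  proof induction
    case empty
    then show ?case by (simp add: switch_empty assms(1))
  next
    case (insert w W)
    then show ?case
      unfolding switch_insert[OF insert.hyps(2)] by (intro diamond_switch_vertex) auto
  qed
qed

section \<open>CR association, extensions and CR tournaments\<close>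

text \<open>If \<open>u\<close> and \<open>w\<close> are on the same side of \<open>W\<close>, their
  signs towards any third vertex change together and the type of association persists. On opposite
  sides exactly one of them changes, so covertices and revertices trade places.\<close>

lemma CR_associated_switch:
  assumes T: "tournament T" and "CR_associated T u w"
  shows "CR_associated (switch T W) u w"
proof -
  have uw: "u \<in> pverts T" "w \<in> pverts T" "u \<noteq> w"
    using assms(2) unfolding CR_associated_def covertices_def revertices_def by blast+
  have th: "theta (switch T W) a v = (if a \<in> W \<longleftrightarrow> v \<in> W then theta T a v else - theta T a v)"
    if "a \<in> {u, w}" "v \<in> pverts T - {u, w}" for a v
    using theta_switch[OF T] that uw by blast
  show ?thesis
  proof (cases "u \<in> W \<longleftrightarrow> w \<in> W")
    case True
    then have "covertices T u w \<Longrightarrow> covertices (switch T W) u w"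
      "revertices T u w \<Longrightarrow> revertices (switch T W) u w"
      unfolding covertices_def revertices_def by (auto simp: th)
    then show ?thesis using assms(2) unfolding CR_associated_def by blast
  next
    case False
    then have "covertices T u w \<Longrightarrow> revertices (switch T W) u w"
      "revertices T u w \<Longrightarrow> covertices (switch T W) u w"
      unfolding covertices_def revertices_def by (auto simp: th)
    then show ?thesis using assms(2) unfolding CR_associated_def by blast
  qed
qed

text \<open>As \<open>u\<close> lies outside \<open>W\<close>, the outer switch reverses its arcs to
  \<open>W\<close>, and the negated signs compensate for this. Negation reverses an arc because the
  signs are 1 or -1: \<open>extension\<close> reads every value other than 1 as an arc into
  \<open>u\<close>.\<close>

lemma extension_switch:
  assumes "W \<subseteq> pverts T" "u \<notin> pverts T" "\<sigma> \<in> pverts T \<rightarrow> {1, - 1}"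
    and "parcs T \<subseteq> pverts T \<times> pverts T"
  shows "extension (switch T W) u \<sigma> =
    switch (extension T u (\<lambda>w. if w \<in> W then - \<sigma> w else \<sigma> w)) W"
proof (rule pair_pre_digraph_eqI)
  have \<sigma>: "\<sigma> w = 1 \<or> \<sigma> w = - 1" if "w \<in> pverts T" for w
    using assms(3) that by auto
  have "u \<notin> W" using assms by blast
  then show "(a, b) \<in> parcs (extension (switch T W) u \<sigma>) \<longleftrightarrow>
    (a, b) \<in> parcs (switch (extension T u (\<lambda>w. if w \<in> W then - \<sigma> w else \<sigma> w)) W)" for a b
    using assms(1,2,4) \<sigma>[of a] \<sigma>[of b] by (auto simp: extension_def parcs_switch)
qed (simp add: extension_def)

text \<open>A non-CR extension of the switch inside \<open>Dclass k\<close> would be the switch of a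
  non-CR extension of \<open>T\<close> inside the same class.\<close>

lemma CR_tournament_switch:
  assumes "CR_tournament T" "W \<subseteq> pverts T"
  shows "CR_tournament (switch T W)"
proof -
  obtain k where k: "odd k" "T \<in> Dclass k - Dclass (k - 2)"
    and alt: "card (pverts T) = 1 \<or> card (pverts T) = 2 \<or> diamond T \<or>
      (\<forall>u \<sigma>. u \<notin> pverts T \<and> \<sigma> \<in> pverts T \<rightarrow> {1, - 1} \<and> \<not> CR_vertex T u \<sigma> \<longrightarrow>
         extension T u \<sigma> \<notin> Dclass k)"
    using assms(1) unfolding CR_tournament_def by blast
  have T: "tournament T" using k unfolding Dclass_def by blast
  have "extension (switch T W) u \<sigma> \<notin> Dclass k"
    if ext: "\<forall>u \<sigma>. u \<notin> pverts T \<and> \<sigma> \<in> pverts T \<rightarrow> {1, - 1} \<and> \<not> CR_vertex T u \<sigma> \<longrightarrow>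
         extension T u \<sigma> \<notin> Dclass k"
      and u: "u \<notin> pverts T" and \<sigma>: "\<sigma> \<in> pverts T \<rightarrow> {1, - 1}"
      and ncr: "\<not> CR_vertex (switch T W) u \<sigma>" for u \<sigma>
  proof -
    define \<tau> where "\<tau> w = (if w \<in> W then - \<sigma> w else \<sigma> w)" for w
    have eq: "extension (switch T W) u \<sigma> = switch (extension T u \<tau>) W"
      unfolding \<tau>_def using T u \<sigma> assms(2)
      by (intro extension_switch) (auto simp: tournament_iff)
    have "\<tau> \<in> pverts T \<rightarrow> {1, - 1}" using \<sigma> by (auto simp: \<tau>_def Pi_iff)
    \<comment> \<open>A partner of \<open>u\<close> in \<open>extension T u \<tau>\<close> would
      remain one after switching by \<open>W\<close>, contradicting \<open>ncr\<close>.\<close>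
    moreover have "\<not> CR_vertex T u \<tau>"
      using ncr CR_associated_switch[OF tournament_extension[OF T u]]
      unfolding CR_vertex_def eq by auto
    ultimately have "extension T u \<tau> \<notin> Dclass k" using ext u by blast
    then show ?thesis unfolding eq Dclass_switch .
  qed
  then show ?thesis
    using k alt diamond_switch[OF _ assms(2)] unfolding CR_tournament_def
    by (intro exI[of _ k]) (auto simp: Dclass_switch)
qed

section \<open>Blowups and strong CR tournaments\<close>

text \<open>Since \<open>x\<close> and \<open>y\<close> land on the same side, the arc from
  \<open>x\<close> to \<open>y\<close> is never reversed. Removing \<open>v\<close> before adding
  them also covers the case that one of them is \<open>v\<close> itself: the union then puts it
  back.\<close>

lemma transitive_blowup_switch:
  assumes "W \<subseteq> pverts T" "x \<notin> pverts T - {v}" "y \<notin> pverts T - {v}"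
    and "parcs T \<subseteq> pverts T \<times> pverts T"
  shows "transitive_blowup (switch T W) v x y =
    switch (transitive_blowup T v x y) (if v \<in> W then W - {v} \<union> {x, y} else W)"
proof (rule pair_pre_digraph_eqI)
  define W' where "W' = (if v \<in> W then W - {v} \<union> {x, y} else W)"
  define U where "U = pverts T - {v}"
  have xy: "z \<in> W' \<longleftrightarrow> v \<in> W" "z \<notin> U" if "z = x \<or> z = y" for z
    using assms that by (auto simp: U_def W'_def)
  have U: "a \<in> W' \<longleftrightarrow> a \<in> W" "a \<noteq> x \<and> a \<noteq> y" if "a \<in> U" for a
    using assms that by (auto simp: U_def W'_def)
  \<comment> \<open>Stated for a general \<open>S\<close>, to be used for both \<open>T\<close> and
    its switch. Splitting by \<open>U\<close> keeps the replaced vertex \<open>v\<close> apart from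
    a new vertex that reuses its name.\<close>
  have mem: "(a, b) \<in> parcs (transitive_blowup S v x y) \<longleftrightarrow>
      (a \<in> U \<and> b \<in> U \<and> (a, b) \<in> parcs S) \<or> ((a = x \<or> a = y) \<and> b \<in> U \<and> (v, b) \<in> parcs S) \<or>
      ((b = x \<or> b = y) \<and> a \<in> U \<and> (a, v) \<in> parcs S) \<or> (a = x \<and> b = y)"
    if "parcs S \<subseteq> pverts T \<times> pverts T"
    for a b and S :: "'a pair_pre_digraph"
  proof -
    have "(a, b) \<in> parcs S \<Longrightarrow> a \<in> pverts T \<and> b \<in> pverts T" for a b using that by blast
    from this[of a b] this[of a v] this[of v b] show ?thesis
      unfolding transitive_blowup_def U_def by auto
  qed
  have "parcs (switch T W) \<subseteq> pverts T \<times> pverts T"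
    using assms(4) by (auto simp: switch_def split: if_splits)
  note arcs_iff = mem[OF this, unfolded parcs_switch]
    parcs_switch[of _ _ "transitive_blowup T v x y"] mem[OF assms(4)]
  have "(a, b) \<in> parcs (transitive_blowup (switch T W) v x y) \<longleftrightarrow>
    (a, b) \<in> parcs (switch (transitive_blowup T v x y) W')" for a b
  proof -
    \<comment> \<open>The last two cases concern elements that are not vertices of the blowup, where
      both sides are false.\<close>
    consider "a \<in> U" "b \<in> U" | "a \<in> U" "b = x \<or> b = y" | "a = x \<or> a = y" "b \<in> U"
      | "a = x \<or> a = y" "b = x \<or> b = y" | "\<not> (a \<in> U \<or> a = x \<or> a = y)" | "\<not> (b \<in> U \<or> b = x \<or> b = y)"
      by blast
    then show ?thesis
    proof cases
      case 1
      then show ?thesis unfolding arcs_iff using U[of a] U[of b] by simp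
    next
      case 2
      then show ?thesis unfolding arcs_iff using U[of a] xy[of b] by simp
    next
      case 3
      then show ?thesis unfolding arcs_iff using xy[of a] U[of b] by simp
    next
      case 4
      then show ?thesis unfolding arcs_iff using xy[of a] xy[of b] by simp
    next
      case 5
      then show ?thesis unfolding arcs_iff by auto
    next
      case 6
      then show ?thesis unfolding arcs_iff by auto
    qed
  qed
  then show "(a, b) \<in> parcs (transitive_blowup (switch T W) v x y) \<longleftrightarrow>
    (a, b) \<in> parcs (switch (transitive_blowup T v x y)
      (if v \<in> W then W - {v} \<union> {x, y} else W))" for a b
    unfolding W'_def .
qed (simp add: transitive_blowup_def)

lemma strong_CR_tournament_switch:
  assumes strong: "strong_CR_tournament T" and W: "W \<subseteq> pverts T"
  shows "strong_CR_tournament (switch T W)"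
  unfolding strong_CR_tournament_def
proof (intro conjI allI impI)
  have CR: "CR_tournament T" using strong unfolding strong_CR_tournament_def by blast
  then show "CR_tournament (switch T W)" using W by (rule CR_tournament_switch)
  have "tournament T" using CR unfolding CR_tournament_def Dclass_def by auto
  then have arcs: "parcs T \<subseteq> pverts T \<times> pverts T" by (simp add: tournament_iff)
  fix T' assume "is_one_transitive_blowup (switch T W) T'"
  then obtain v x y where v: "v \<in> pverts T" "x \<noteq> y" "x \<notin> pverts T - {v}" "y \<notin> pverts T - {v}"
    and T': "T' = transitive_blowup (switch T W) v x y"
    unfolding is_one_transitive_blowup_def by auto
  \<comment> \<open>The same \<open>v\<close>, \<open>x\<close> and \<open>y\<close> give a blowup
    of \<open>T\<close>, of which \<open>T'\<close> is a switch.\<close>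
  then have "CR_tournament (transitive_blowup T v x y)"
    using strong unfolding strong_CR_tournament_def is_one_transitive_blowup_def by blast
  then show "CR_tournament T'"
    unfolding T' transitive_blowup_switch[OF W v(3,4) arcs]
    by (rule CR_tournament_switch) (use W in \<open>auto simp: transitive_blowup_def\<close>)
qed

theorem theorem4p4:
  fixes T1 T2 :: "'a::infinite pair_pre_digraph" and V :: "'a set"
  assumes "tournament T1" and "tournament T2"
    and "pverts T1 = V" and "pverts T2 = V"
    and "switching_equivalent T1 T2"
  shows "strong_CR_tournament T1 \<longleftrightarrow> strong_CR_tournament T2"
proof -
  obtain W where W: "W \<subseteq> pverts T1" "T2 = switch T1 W"
    using assms(5) unfolding switching_equivalent_def by blast
  \<comment> \<open>For the converse, \<open>T1\<close> is recovered from \<open>T2\<close> by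
    switching with the same \<open>W\<close>.\<close>
  then show ?thesis
    using strong_CR_tournament_switch[of T1 W] strong_CR_tournament_switch[of T2 W]
    by (auto simp: switch_switch)
qed

end
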